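(* Let $G$ be an interval graph and $T$ a PQ tree of $G$. Let $X$ be a node of $T$ with children $X_1,\ldots,X_k$ (in their current left-to-right order), let $u,v\in X$, and let $T_X$ be the subtree of $T$ rooted at $X$. Then: (i) if $v$ belongs to every leaf of $T_X$, then $T_X$ is compatible with $u<v$; (ii) if $X_i,X_j\in\{X_1,\ldots,X_k\}$ are such that $u\in X_i$, $v\notin X_i$, $v\in X_j$, and $T_X$ is compatible with $u<v$, then $X_i$ precedes $X_j$ among the children of $X$.
   Context: A PQ tree of an interval graph $G$ is an ordered rooted tree whose leaves are the maximal cliques of $G$ and whose internal nodes are of type P or Q; equivalent trees are obtained by permuting children of P nodes or reversing children of Q nodes, and the left-to-right leaf sequences of the trees equivalent to $T$ are exactly the canonical clique orderings of $G$ (orderings $C_1,\ldots,C_t$ of the maximal cliques such that each vertex lies in a set of consecutive cliques). A vertex $v$ belongs to a node $X$ (written $v\in X$) if $v$ belongs to some leaf descending from $X$. For a (sub)tree $T'$ with left-to-right leaf sequence $s_{T'}=C_1,\ldots,C_t$, let $G'$ be the subgraph induced by the union of its leaves; $T'$ is compatible with the restriction $u<v$ if there is a canonical ordering $s$ of $G'$ (an ordering such that for all $p$ before $q$ before $r$, $(p,r)\in E$ implies $(q,r)\in E$) that is ordered according to $s_{T'}$ (i.e., for all $a$ before $b$ in $s$ there are no $i<j$ with $b\in C_i\setminus C_j$ and $a\in C_j$) and in which $u$ precedes $v$. *)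

theory Defs
  imports "Graph_Theory.Graph_Theory" "HOL-Library.Multiset"
begin

text \<open>A finite simple graph is a symmetric loop-free digraph without parallel arcs, i.e. an
  instance of the locale \<^locale>\<open>graph\<close>; an undirected edge is a pair of opposite arcs and
  adjacency of \<open>u\<close> and \<open>v\<close> is \<open>u \<rightarrow>\<^bsub>G\<^esub> v\<close>.\<close>

definition interval_graph :: "('a, 'b) pre_digraph \<Rightarrow> bool" where
  "interval_graph G \<longleftrightarrow>
     graph G \<and>
     (\<exists>l r :: 'a \<Rightarrow> real.
        (\<forall>v \<in> verts G. l v \<le> r v) \<and>
        (\<forall>u \<in> verts G. \<forall>v \<in> verts G. u \<noteq> v \<longrightarrow>
           (u \<rightarrow>\<^bsub>G\<^esub> v \<longleftrightarrow> {l u..r u} \<inter> {l v..r v} \<noteq> {})))"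

definition is_clique :: "('a, 'b) pre_digraph \<Rightarrow> 'a set \<Rightarrow> bool" where
  "is_clique G C \<longleftrightarrow> C \<subseteq> verts G \<and> (\<forall>u \<in> C. \<forall>v \<in> C. u \<noteq> v \<longrightarrow> u \<rightarrow>\<^bsub>G\<^esub> v)"

definition max_cliques :: "('a, 'b) pre_digraph \<Rightarrow> 'a set set" where
  "max_cliques G = {C. is_clique G C \<and> (\<forall>D. is_clique G D \<longrightarrow> C \<subseteq> D \<longrightarrow> D = C)}"

definition canonical_clique_ordering :: "('a, 'b) pre_digraph \<Rightarrow> 'a set list \<Rightarrow> bool" where
  "canonical_clique_ordering G Cs \<longleftrightarrow>
     distinct Cs \<and> set Cs = max_cliques G \<and>
     (\<forall>v i j k. i \<le> j \<longrightarrow> j \<le> k \<longrightarrow> k < length Cs \<longrightarrow> v \<in> Cs ! i \<longrightarrow> v \<in> Cs ! k \<longrightarrow> v \<in> Cs ! j)"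

datatype 'a pqtree =
    Leaf "'a set"
  | PNode "'a pqtree list"
  | QNode "'a pqtree list"

fun children :: "'a pqtree \<Rightarrow> 'a pqtree list" where
  "children (Leaf C) = []"
| "children (PNode ts) = ts"
| "children (QNode ts) = ts"

fun leaf_sequence :: "'a pqtree \<Rightarrow> 'a set list" where
  "leaf_sequence (Leaf C) = [C]"
| "leaf_sequence (PNode ts) = concat (map leaf_sequence ts)"
| "leaf_sequence (QNode ts) = concat (map leaf_sequence ts)"

text \<open>A node is identified with the subtree rooted at it. In the trees satisfying
  \<open>is_pq_tree\<close> below, distinct nodes have distinct subtrees, because the leaves are pairwise
  distinct and every internal node has a leaf below it.\<close>

inductive_set nodes :: "'a pqtree \<Rightarrow> 'a pqtree set" for T :: "'a pqtree" where
  root: "T \<in> nodes T"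
| child: "X \<in> nodes T \<Longrightarrow> Y \<in> set (children X) \<Longrightarrow> Y \<in> nodes T"

definition belongs :: "'a \<Rightarrow> 'a pqtree \<Rightarrow> bool" where
  "belongs v X \<longleftrightarrow> (\<exists>C \<in> set (leaf_sequence X). v \<in> C)"

inductive pq_step :: "'a pqtree \<Rightarrow> 'a pqtree \<Rightarrow> bool" where
  permute: "mset ts = mset ts' \<Longrightarrow> pq_step (PNode ts) (PNode ts')"
| reverse: "pq_step (QNode ts) (QNode (rev ts))"
| in_P: "pq_step t t' \<Longrightarrow> pq_step (PNode (xs @ t # ys)) (PNode (xs @ t' # ys))"
| in_Q: "pq_step t t' \<Longrightarrow> pq_step (QNode (xs @ t # ys)) (QNode (xs @ t' # ys))"

definition pq_equivalent :: "'a pqtree \<Rightarrow> 'a pqtree \<Rightarrow> bool" where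
  "pq_equivalent = equivclp pq_step"

text \<open>No lower bound other than one is put on the number of children of an internal node.\<close>

definition is_pq_tree :: "('a, 'b) pre_digraph \<Rightarrow> 'a pqtree \<Rightarrow> bool" where
  "is_pq_tree G T \<longleftrightarrow>
     PNode [] \<notin> nodes T \<and> QNode [] \<notin> nodes T \<and>
     set (leaf_sequence T) = max_cliques G \<and>
     leaf_sequence ` {T'. pq_equivalent T T'} = {Cs. canonical_clique_ordering G Cs}"

definition precedes :: "'a list \<Rightarrow> 'a \<Rightarrow> 'a \<Rightarrow> bool" where
  "precedes s a b \<longleftrightarrow> (\<exists>i j. i < j \<and> j < length s \<and> s ! i = a \<and> s ! j = b)"

definition canonical_ordering :: "('a, 'b) pre_digraph \<Rightarrow> 'a list \<Rightarrow> bool" where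
  "canonical_ordering G s \<longleftrightarrow>
     distinct s \<and> set s = verts G \<and>
     (\<forall>p q r. precedes s p q \<longrightarrow> precedes s q r \<longrightarrow> p \<rightarrow>\<^bsub>G\<^esub> r \<longrightarrow> q \<rightarrow>\<^bsub>G\<^esub> r)"

definition ordered_according_to :: "'a list \<Rightarrow> 'a set list \<Rightarrow> bool" where
  "ordered_according_to s Cs \<longleftrightarrow>
     (\<forall>a b. precedes s a b \<longrightarrow>
        \<not> (\<exists>i j. i < j \<and> j < length Cs \<and> b \<in> Cs ! i - Cs ! j \<and> a \<in> Cs ! j))"

definition pq_compatible :: "('a, 'b) pre_digraph \<Rightarrow> 'a pqtree \<Rightarrow> 'a \<Rightarrow> 'a \<Rightarrow> bool" where
  "pq_compatible G T' u v \<longleftrightarrow>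
     (\<exists>s. canonical_ordering (G \<restriction> \<Union> (set (leaf_sequence T'))) s \<and>
          ordered_according_to s (leaf_sequence T') \<and> precedes s u v)"

end

theory Submission
  imports Defs
begin

text \<open>The leaves below \<open>X\<close> form a contiguous segment of the canonical clique ordering read off
  \<open>T\<close>, so two vertices of \<open>X\<close> that are adjacent already share a leaf below \<open>X\<close>: a common
  clique outside the segment forces both into its first or last leaf. Hence every ordering of the
  vertices of \<open>X\<close> by the last leaf containing them is canonical and ordered according to the
  leaves. For (i), such a \<open>v\<close> has the largest possible last leaf and can be put at the very end.
  For (ii), if \<open>X\<^sub>j\<close> preceded \<open>X\<^sub>i\<close>, a leaf of \<open>X\<^sub>j\<close> containing \<open>v\<close> and a later leaf of \<open>X\<^sub>i\<close>
  containing \<open>u\<close> but not \<open>v\<close> would forbid \<open>u\<close> before \<open>v\<close>.\<close>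

section \<open>Consecutive set sequences and their segments\<close>

definition consecutive :: "'a set list \<Rightarrow> bool" where
  "consecutive Cs \<longleftrightarrow>
     (\<forall>v i j k. i \<le> j \<longrightarrow> j \<le> k \<longrightarrow> k < length Cs \<longrightarrow> v \<in> Cs ! i \<longrightarrow> v \<in> Cs ! k \<longrightarrow> v \<in> Cs ! j)"

lemma consecutiveD:
  assumes "consecutive Cs" "i \<le> j" "j \<le> k" "k < length Cs" "v \<in> Cs ! i" "v \<in> Cs ! k"
  shows "v \<in> Cs ! j"
  using assms unfolding consecutive_def by blast

lemma consecutive_rev:
  assumes "consecutive Cs"
  shows "consecutive (rev Cs)"
  unfolding consecutive_def
proof (intro allI impI)
  fix v i j k
  assume "i \<le> j" "j \<le> k" "k < length (rev Cs)" "v \<in> rev Cs ! i" "v \<in> rev Cs ! k"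
  then show "v \<in> rev Cs ! j"
    \<comment> \<open>Reflecting the indices swaps the roles of \<open>i\<close> and
      \<open>k\<close>.\<close>
    using consecutiveD[OF assms, of "length Cs - Suc k" "length Cs - Suc j" "length Cs - Suc i" v]
    by (simp add: rev_nth)
qed

text \<open>A segment need not list all maximal cliques, so \<open>canonical_clique_ordering\<close>
  is not inherited by it; consecutivity alone is.\<close>

lemma consecutive_appendD1:
  assumes "consecutive (As @ Bs)"
  shows "consecutive As"
  unfolding consecutive_def
proof (intro allI impI)
  fix v i j k
  assume "i \<le> j" "j \<le> k" "k < length As" "v \<in> As ! i" "v \<in> As ! k"
  then show "v \<in> As ! j"
    using consecutiveD[OF assms, of i j k v] by (simp add: nth_append)
qed

lemma consecutive_appendD2:
  assumes "consecutive (As @ Bs)"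
  shows "consecutive Bs"
  using assms consecutive_appendD1[of "rev Bs" "rev As"] consecutive_rev
  by (metis rev_append rev_rev_ident)

text \<open>The head of \<open>Bs\<close> sits at index \<open>length As\<close>, between the
  occurrence of \<open>v\<close> in \<open>As\<close> and the one in \<open>Bs\<close>.\<close>

lemma consecutive_hd_mem:
  assumes "consecutive (As @ Bs)" "C \<in> set As" "v \<in> C" "D \<in> set Bs" "v \<in> D"
  shows "v \<in> hd Bs"
proof -
  obtain i k where i: "i < length As" "As ! i = C" and k: "k < length Bs" "Bs ! k = D"
    using assms by (metis in_set_conv_nth)
  have "v \<in> (As @ Bs) ! length As"
    using consecutiveD[OF assms(1), of i "length As" "length As + k" v] i k assms
    by (simp add: nth_append)
  then show ?thesis using assms(4) by (cases Bs) auto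
qed

lemma consecutive_last_mem:
  assumes "consecutive (As @ Bs)" "C \<in> set Bs" "v \<in> C" "D \<in> set As" "v \<in> D"
  shows "v \<in> last As"
  using consecutive_hd_mem[of "rev Bs" "rev As" C v D] consecutive_rev[OF assms(1)] assms
  by (simp add: hd_rev)

text \<open>\<open>D\<close> and \<open>E\<close> may differ. If \<open>C\<close> lies left of the
  segment, the runs of \<open>p\<close> and of \<open>q\<close> both cover \<open>hd Cs\<close>; if
  it lies to the right, both cover \<open>last Cs\<close>.\<close>

lemma segment_common_clique:
  assumes cons: "consecutive (As @ Cs @ Bs)"
    and p: "D \<in> set Cs" "p \<in> D" and q: "E \<in> set Cs" "q \<in> E"
    and C: "C \<in> set (As @ Cs @ Bs)" "p \<in> C" "q \<in> C"
  shows "\<exists>C \<in> set Cs. p \<in> C \<and> q \<in> C"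
proof -
  have ne: "Cs \<noteq> []" using p by auto
  have cons1: "consecutive (As @ Cs)"
    using consecutive_appendD1[of "As @ Cs" Bs] cons by simp
  have cons2: "consecutive (Cs @ Bs)"
    using cons by (rule consecutive_appendD2)
  consider "C \<in> set As" | "C \<in> set Cs" | "C \<in> set Bs" using C(1) by auto
  then show ?thesis
  proof cases
    case 1
    then have "p \<in> hd Cs" "q \<in> hd Cs" using consecutive_hd_mem[OF cons1] p q C by blast+
    then show ?thesis using ne hd_in_set by blast
  next
    case 2
    then show ?thesis using C by blast
  next
    case 3
    then have "p \<in> last Cs" "q \<in> last Cs" using consecutive_last_mem[OF cons2] p q C by blast+
    then show ?thesis using ne last_in_set by blast
  qed
qed

section \<open>Leaf sequences of nodes and of their children\<close>

lemma concat_map_split: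
  assumes "i < length ts"
  shows "concat (map f ts) =
    concat (map f (take i ts)) @ f (ts ! i) @ concat (map f (drop (Suc i) ts))"
  by (subst id_take_nth_drop[OF assms]) simp

text \<open>A valid child index excludes \<open>Leaf\<close>, where the equation fails.\<close>

lemma leaf_sequence_children:
  assumes "i < length (children X)"
  shows "leaf_sequence X = concat (map leaf_sequence (children X))"
  using assms by (cases X) auto

text \<open>Induction along the path from the root: each descent to a child adds the leaves of its
  siblings to the two outer lists.\<close>

lemma leaf_sequence_node_segment:
  assumes "X \<in> nodes T"
  shows "\<exists>As Bs. leaf_sequence T = As @ leaf_sequence X @ Bs"
  using assms
proof induction
  case root
  have "leaf_sequence T = [] @ leaf_sequence T @ []" by simp
  then show ?case by blast
next
  case (child X Y)
  then obtain As Bs where T: "leaf_sequence T = As @ leaf_sequence X @ Bs" by blast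
  obtain i where i: "i < length (children X)" "children X ! i = Y"
    using child by (metis in_set_conv_nth)
  obtain As' Bs' where "leaf_sequence X = As' @ leaf_sequence Y @ Bs'"
    using leaf_sequence_children[OF i(1)] concat_map_split[OF i(1), of leaf_sequence] i(2) by metis
  then have "leaf_sequence T = (As @ As') @ leaf_sequence Y @ (Bs' @ Bs)" using T by simp
  then show ?case by blast
qed

lemma leaves_of_children_ordered:
  assumes "j < i" "i < length (children X)"
    and "D \<in> set (leaf_sequence (children X ! j))" and "C \<in> set (leaf_sequence (children X ! i))"
  shows "\<exists>m n. m < n \<and> n < length (leaf_sequence X) \<and>
    leaf_sequence X ! m = D \<and> leaf_sequence X ! n = C"
proof -
  define As where "As = concat (map leaf_sequence (take i (children X)))"
  obtain Bs where X: "leaf_sequence X = As @ leaf_sequence (children X ! i) @ Bs"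
    using leaf_sequence_children[OF assms(2)] concat_map_split[OF assms(2), of leaf_sequence]
    unfolding As_def by metis
  have "children X ! j \<in> set (take i (children X))"
    using assms(1,2) by (auto simp: in_set_conv_nth intro!: exI[of _ j])
  then have "D \<in> set As" unfolding As_def using assms(3) by auto
  then obtain m n where "m < length As" "As ! m = D"
      "n < length (leaf_sequence (children X ! i))" "leaf_sequence (children X ! i) ! n = C"
    using assms(4) by (metis in_set_conv_nth)
  \<comment> \<open>The leaf \<open>D\<close> is found inside the prefix \<open>As\<close>, while
    the position of \<open>C\<close> is shifted by the length of \<open>As\<close>.\<close>
  then show ?thesis
    unfolding X by (intro exI[of _ m] exI[of _ "length As + n"]) (simp add: nth_append)
qed

section \<open>Adjacency and maximal cliques\<close>

lemma adj_induce_subgraph_iff: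
  "p \<rightarrow>\<^bsub>G \<restriction> V\<^esub> q \<longleftrightarrow> p \<rightarrow>\<^bsub>G\<^esub> q \<and> p \<in> V \<and> q \<in> V"
  by (auto simp: arcs_ends_def arc_to_ends_def induce_subgraph_def image_iff)

text \<open>A maximal element of the finite family of cliques above \<open>C\<close> is maximal
  among all cliques, since any clique containing it is again above \<open>C\<close>.\<close>

lemma clique_extends_to_max_clique:
  assumes fin: "finite (verts G)" and "is_clique G C"
  shows "\<exists>M \<in> max_cliques G. C \<subseteq> M"
proof -
  have "finite {D. is_clique G D \<and> C \<subseteq> D}"
    by (rule finite_subset[of _ "Pow (verts G)"]) (auto simp: is_clique_def fin)
  then obtain M where M: "is_clique G M" "C \<subseteq> M"
      "\<And>D. is_clique G D \<Longrightarrow> C \<subseteq> D \<Longrightarrow> M \<subseteq> D \<Longrightarrow> M = D"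
    using finite_has_maximal2[of "{D. is_clique G D \<and> C \<subseteq> D}" C] assms(2) by auto
  then have "M \<in> max_cliques G" unfolding max_cliques_def by blast
  then show ?thesis using M(2) by blast
qed

text \<open>The ends of an edge form a clique, symmetry supplying the opposite arc.\<close>

lemma adjacent_in_max_clique:
  assumes "graph G" "p \<rightarrow>\<^bsub>G\<^esub> q"
  shows "\<exists>M \<in> max_cliques G. p \<in> M \<and> q \<in> M"
proof -
  interpret graph G by fact
  have "is_clique G {p, q}"
    unfolding is_clique_def
    using assms(2) adj_in_verts[OF assms(2)] arcs_ends_symmetric[OF sym_arcs assms(2)] by auto
  then show ?thesis using clique_extends_to_max_clique[of G "{p, q}"] by auto
qed

section \<open>Vertex orderings sorted by last clique\<close>

definition last_index :: "'a set list \<Rightarrow> 'a \<Rightarrow> nat" where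
  "last_index Cs a = Max {i. i < length Cs \<and> a \<in> Cs ! i}"

lemma last_index_ge:
  assumes "i < length Cs" "a \<in> Cs ! i"
  shows "i \<le> last_index Cs a"
  unfolding last_index_def using assms by (intro Max_ge) auto

text \<open>Membership in some set of the list keeps \<open>Max\<close> away from the empty
  set.\<close>

lemma last_index_mem:
  assumes "a \<in> \<Union> (set Cs)"
  shows "last_index Cs a < length Cs" "a \<in> Cs ! last_index Cs a"
proof -
  have "{i. i < length Cs \<and> a \<in> Cs ! i} \<noteq> {}" using assms by (auto simp: in_set_conv_nth)
  then have "last_index Cs a \<in> {i. i < length Cs \<and> a \<in> Cs ! i}"
    unfolding last_index_def by (intro Max_in) auto
  then show "last_index Cs a < length Cs" "a \<in> Cs ! last_index Cs a" by auto
qed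

lemma sorted_last_index_precedes:
  assumes "sorted (map (last_index Cs) s)" "precedes s a b"
  shows "last_index Cs a \<le> last_index Cs b" "a \<in> set s" "b \<in> set s"
proof -
  obtain i j where ij: "i < j" "j < length s" "s ! i = a" "s ! j = b"
    using assms(2) unfolding precedes_def by blast
  then show "last_index Cs a \<le> last_index Cs b"
    using sorted_nth_mono[OF assms(1), of i j] by simp
  show "a \<in> set s" "b \<in> set s" using ij by auto
qed

text \<open>In a violating pair, \<open>a\<close> pushes the last index of \<open>b\<close> to at
  least \<open>j\<close>; since \<open>b\<close> already occurs at \<open>i < j\<close>, its run
  must cover \<open>j\<close>.\<close>

lemma ordered_according_to_sorted:
  assumes cons: "consecutive Cs" and s: "set s = \<Union> (set Cs)" "sorted (map (last_index Cs) s)"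
  shows "ordered_according_to s Cs"
  unfolding ordered_according_to_def
proof (intro allI impI notI)
  fix a b
  assume "precedes s a b"
    and "\<exists>i j. i < j \<and> j < length Cs \<and> b \<in> Cs ! i - Cs ! j \<and> a \<in> Cs ! j"
  then obtain i j where ij: "i < j" "j < length Cs" "b \<in> Cs ! i" "b \<notin> Cs ! j" "a \<in> Cs ! j"
    by blast
  note le = sorted_last_index_precedes[OF s(2) \<open>precedes s a b\<close>]
  have "j \<le> last_index Cs b" using last_index_ge[OF ij(2,5)] le(1) by simp
  moreover have "last_index Cs b < length Cs" "b \<in> Cs ! last_index Cs b"
    using last_index_mem[of b Cs] le(3) s(1) by simp_all
  ultimately have "b \<in> Cs ! j" using consecutiveD[OF cons _ _ _ ij(3)] ij(1) by simp
  then show False using ij(4) by simp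
qed

text \<open>If \<open>p\<close> and \<open>r\<close> share the set at index \<open>m\<close>, then
  \<open>m\<close> \<le> \<open>last_index Cs q\<close> \<le> \<open>last_index Cs r\<close>. The
  run of \<open>r\<close> therefore covers the last set of \<open>q\<close>, and this clique joins
  \<open>q\<close> to \<open>r\<close>.\<close>

lemma canonical_ordering_sorted:
  assumes cons: "consecutive Cs" and cliques: "\<And>C. C \<in> set Cs \<Longrightarrow> is_clique G C"
    and adj: "\<And>p q. p \<in> \<Union> (set Cs) \<Longrightarrow> q \<in> \<Union> (set Cs) \<Longrightarrow> p \<rightarrow>\<^bsub>G\<^esub> q \<Longrightarrow>
      \<exists>C \<in> set Cs. p \<in> C \<and> q \<in> C"
    and s: "set s = \<Union> (set Cs)" "distinct s" "sorted (map (last_index Cs) s)"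
  shows "canonical_ordering (G \<restriction> \<Union> (set Cs)) s"
  unfolding canonical_ordering_def
proof (intro conjI allI impI)
  show "distinct s" by fact
  show "set s = verts (G \<restriction> \<Union> (set Cs))" using s(1) by simp
  fix p q r
  assume pq: "precedes s p q" and qr: "precedes s q r" and pr: "p \<rightarrow>\<^bsub>G \<restriction> \<Union> (set Cs)\<^esub> r"
  note le1 = sorted_last_index_precedes[OF s(3) pq] and le2 = sorted_last_index_precedes[OF s(3) qr]
  have "p \<in> \<Union> (set Cs)" and "r \<in> \<Union> (set Cs)" and "p \<rightarrow>\<^bsub>G\<^esub> r"
    using pr unfolding adj_induce_subgraph_iff by blast+
  from adj[OF this] obtain m where m: "m < length Cs" "p \<in> Cs ! m" "r \<in> Cs ! m"
    by (auto simp: in_set_conv_nth)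
  have q: "last_index Cs q < length Cs" "q \<in> Cs ! last_index Cs q"
    and r: "last_index Cs r < length Cs" "r \<in> Cs ! last_index Cs r"
    using last_index_mem[of q Cs] last_index_mem[of r Cs] le2(2,3) s(1) by simp_all
  have "m \<le> last_index Cs q" using last_index_ge[OF m(1,2)] le1(1) by simp
  then have "r \<in> Cs ! last_index Cs q" using consecutiveD[OF cons _ le2(1) r(1) m(3) r(2)] by simp
  moreover have "q \<noteq> r" using qr s(2) unfolding precedes_def by (auto simp: nth_eq_iff_index_eq)
  ultimately have "q \<rightarrow>\<^bsub>G\<^esub> r"
    using cliques[OF nth_mem[OF q(1)]] q(2) unfolding is_clique_def by blast
  then show "q \<rightarrow>\<^bsub>G \<restriction> \<Union> (set Cs)\<^esub> r"
    using le2 s(1) by (simp add: adj_induce_subgraph_iff)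
qed

lemma ex_sorted_last_index_ending_in:
  assumes fin: "finite (\<Union> (set Cs))" and v: "v \<in> \<Union> (set Cs)" "\<forall>C \<in> set Cs. v \<in> C"
  shows "\<exists>s. set (s @ [v]) = \<Union> (set Cs) \<and> distinct (s @ [v]) \<and>
    sorted (map (last_index Cs) (s @ [v]))"
proof -
  obtain l where l: "set l = \<Union> (set Cs) - {v}" "distinct l"
    using finite_distinct_list fin by (meson finite_Diff)
  define s where "s = sort_key (last_index Cs) l"
  have "last_index Cs a \<le> last_index Cs v" if "a \<in> set l" for a
  proof -
    have "last_index Cs a < length Cs" using that l(1) last_index_mem(1)[of a Cs] by blast
    \<comment> \<open>The set at index \<open>last_index Cs a\<close> contains \<open>v\<close> as
      well.\<close>
    then show ?thesis using v(2) by (intro last_index_ge) auto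
  qed
  then have "sorted (map (last_index Cs) (s @ [v]))"
    by (auto simp: s_def sorted_append)
  moreover have "set (s @ [v]) = \<Union> (set Cs)" "distinct (s @ [v])"
    using l v(1) by (auto simp: s_def)
  ultimately show ?thesis by blast
qed

section \<open>Compatibility at a node of a PQ tree\<close>

lemma consecutive_leaf_sequence:
  assumes "is_pq_tree G T"
  shows "consecutive (leaf_sequence T)"
proof -
  \<comment> \<open>Reflexivity puts the leaf sequence of \<open>T\<close> itself among the
    canonical ones.\<close>
  have "pq_equivalent T T" unfolding pq_equivalent_def by simp
  then have "canonical_clique_ordering G (leaf_sequence T)"
    using assms unfolding is_pq_tree_def by blast
  then show ?thesis unfolding canonical_clique_ordering_def consecutive_def by blast
qed

lemma pq_compatible_universal:
  assumes G: "graph G" and T: "is_pq_tree G T" and X: "X \<in> nodes T"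
    and u: "belongs u X" and v: "belongs v X" and "u \<noteq> v"
    and all: "\<forall>C \<in> set (leaf_sequence X). v \<in> C"
  shows "pq_compatible G X u v"
proof -
  interpret graph G by fact
  let ?Cs = "leaf_sequence X"
  obtain As Bs where seg: "leaf_sequence T = As @ ?Cs @ Bs"
    using leaf_sequence_node_segment[OF X] by blast
  have consT: "consecutive (As @ ?Cs @ Bs)" using consecutive_leaf_sequence[OF T] seg by simp
  have cons: "consecutive ?Cs" using consT consecutive_appendD1 consecutive_appendD2 by blast
  have leaves: "set (As @ ?Cs @ Bs) = max_cliques G" using T seg unfolding is_pq_tree_def by simp
  have cliques: "is_clique G C" if "C \<in> set ?Cs" for C
    using that leaves unfolding max_cliques_def by auto
  \<comment> \<open>The edge lies in some leaf of \<open>T\<close>; the segment argument moves it to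
    a leaf below \<open>X\<close>.\<close>
  have adj: "\<exists>C \<in> set ?Cs. p \<in> C \<and> q \<in> C"
    if pq: "p \<in> \<Union> (set ?Cs)" "q \<in> \<Union> (set ?Cs)" "p \<rightarrow>\<^bsub>G\<^esub> q" for p q
  proof -
    obtain C where C: "C \<in> set (As @ ?Cs @ Bs)" "p \<in> C" "q \<in> C"
      using adjacent_in_max_clique[OF G pq(3)] leaves by blast
    obtain D E where "D \<in> set ?Cs" "p \<in> D" "E \<in> set ?Cs" "q \<in> E" using pq(1,2) by blast
    then show ?thesis using segment_common_clique[OF consT _ _ _ _ C] by simp
  qed
  have uv: "u \<in> \<Union> (set ?Cs)" "v \<in> \<Union> (set ?Cs)" using u v unfolding belongs_def by blast+
  have "\<Union> (set ?Cs) \<subseteq> verts G" using cliques unfolding is_clique_def by blast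
  then have "finite (\<Union> (set ?Cs))" using finite_subset finite_verts by blast
  from ex_sorted_last_index_ending_in[OF this uv(2) all] obtain s
    where s: "set (s @ [v]) = \<Union> (set ?Cs)" "distinct (s @ [v])"
      "sorted (map (last_index ?Cs) (s @ [v]))" by blast
  have "u \<in> set s" using uv(1) s(1) \<open>u \<noteq> v\<close> by auto
  then obtain i where "i < length s" "s ! i = u" by (metis in_set_conv_nth)
  then have "precedes (s @ [v]) u v"
    unfolding precedes_def by (intro exI[of _ i] exI[of _ "length s"]) (simp add: nth_append)
  moreover have "canonical_ordering (G \<restriction> \<Union> (set ?Cs)) (s @ [v])"
    by (rule canonical_ordering_sorted[OF cons cliques adj s])
  moreover have "ordered_according_to (s @ [v]) ?Cs"
    by (rule ordered_according_to_sorted[OF cons s(1,3)])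
  ultimately show ?thesis unfolding pq_compatible_def by blast
qed

lemma pq_compatible_child_order:
  assumes ij: "i < length (children X)" "j < length (children X)"
    and u: "belongs u (children X ! i)" and v: "\<not> belongs v (children X ! i)"
      "belongs v (children X ! j)"
    and compat: "pq_compatible G X u v"
  shows "i < j"
proof (rule ccontr)
  assume "\<not> i < j"
  \<comment> \<open>Equality is impossible because \<open>v\<close> belongs to child
    \<open>j\<close> but not to child \<open>i\<close>.\<close>
  then have "j < i" using v by (cases "i = j") auto
  obtain C D where C: "C \<in> set (leaf_sequence (children X ! i))" "u \<in> C" "v \<notin> C"
    and D: "D \<in> set (leaf_sequence (children X ! j))" "v \<in> D"
    using u v unfolding belongs_def by blast
  obtain m n where "m < n" "n < length (leaf_sequence X)"
      "leaf_sequence X ! m = D" "leaf_sequence X ! n = C"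
    using leaves_of_children_ordered[OF \<open>j < i\<close> ij(1) D(1) C(1)] by blast
  then show False
    using compat C D unfolding pq_compatible_def ordered_according_to_def by blast
qed

theorem theorem6:
  fixes G :: "('a, 'b) pre_digraph" and T X :: "'a pqtree" and u v :: 'a
  assumes "interval_graph G"
    and "is_pq_tree G T"
    and "X \<in> nodes T"
    and "belongs u X" and "belongs v X" and "u \<noteq> v"
  shows "((\<forall>C \<in> set (leaf_sequence X). v \<in> C) \<longrightarrow> pq_compatible G X u v) \<and>
         (\<forall>i j. i < length (children X) \<longrightarrow> j < length (children X) \<longrightarrow>
            belongs u (children X ! i) \<longrightarrow> \<not> belongs v (children X ! i) \<longrightarrow>
            belongs v (children X ! j) \<longrightarrow> pq_compatible G X u v \<longrightarrow> i < j)"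
proof -
  have G: "graph G" using assms(1) unfolding interval_graph_def by blast
  show ?thesis
    using pq_compatible_universal[OF G assms(2-6)] pq_compatible_child_order[of _ X _ u v G] by blast
qed

end
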